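(* Let $B:\mathbb{Z}\to \mathrm{M}(2,\mathbb{C})$ be bounded, i.e. $\sup_{j\in\mathbb{Z}}\|B(j)\|<\infty$. Then $B$ admits dominated splitting if and only if $B$ satisfies both (SVG) and (FI), i.e. if and only if there exist constants $C>0$, $\mu>1$ and $0<\varepsilon<\mu$ such that $$\text{(SVG)}\quad \sup_{j\in\mathbb{Z}}\left\{\frac{\sigma_2(B_n(j))}{\sigma_1(B_{n+1}(j))},\ \frac{\sigma_2(B_n(j+1))}{\sigma_1(B_{n+1}(j))}\right\}<C\mu^{-n}\quad\text{for all } n\ge 0,$$ $$\text{(FI)}\quad \sup_{j\in\mathbb{Z}}\left\{\frac{\sigma_1(B_n(j))}{\sigma_1(B_{n+1}(j))},\ \frac{\sigma_1(B_n(j+1))}{\sigma_1(B_{n+1}(j))}\right\}<C\mu^{(1-\varepsilon)n}\quad\text{for all } n\ge 1.$$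
   Context: $\mathrm{M}(2,\mathbb{C})$ is the space of complex $2\times2$ matrices, $\|\cdot\|$ is the operator norm (for the Euclidean norm on $\mathbb{C}^2$). For $B:\mathbb{Z}\to\mathrm{M}(2,\mathbb{C})$, $B_n(j)=B(j+n-1)\cdots B(j)$ for $n\ge1$ and $B_0(j)=I_2$. For a nonzero $A\in\mathrm{M}(2,\mathbb{C})$, $\sigma_1(A)=\|A\|$ and $\sigma_2(A)=|\det A|/\|A\|$ (the singular values). The conditions (SVG) and (FI) are understood to include the requirement that all matrices $B_n(j)$ appearing in them are nonzero. (SVG) and (FI) use the same $\mu$. Distance on lines: for one-dimensional subspaces $V,W$ of $\mathbb{C}^2$ spanned by unit vectors $\vec v,\vec w$, $d(V,W)=2|\det(\vec v,\vec w)|$, where $(\vec v,\vec w)$ is the matrix with columns $\vec v,\vec w$. Dominated splitting: $B$ admits dominated splitting if for each $j\in\mathbb{Z}$ there are one-dimensional subspaces $E^u(j),E^s(j)$ of $\mathbb{C}^2$ such that: (a) $B(j)[E^u(j)]\subseteq E^u(j+1)$ and $B(j)[E^s(j)]\subseteq E^s(j+1)$ for all $j$; (b) there exist $N\in\mathbb{Z}_+$ (positive integer) and $\lambda>1$ such that $\|B_N(j)\vec u(j)\|>\lambda\|B_N(j)\vec s(j)\|$ for all $j\in\mathbb{Z}$ and all unit vectors $\vec u(j)\in E^u(j)$, $\vec s(j)\in E^s(j)$; (c) $\inf_{j\in\mathbb{Z}}d(E^u(j),E^s(j))>0$; (d) for the same $N$ as in (b), $\inf_{j\in\mathbb{Z}}\|B_N(j)\|>0$.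 *)

theory Defs
  imports "HOL-Analysis.Analysis"
begin

text \<open>
  The norm of \<^typ>\<open>complex^2\<close> is the Euclidean norm, so \<^const>\<open>onorm\<close> gives the operator norm;
  the norm of \<^typ>\<open>complex^2^2\<close> itself is the Frobenius norm and is not used.
\<close>

abbreviation opnorm :: "complex^2^2 \<Rightarrow> real" where
  "opnorm A \<equiv> onorm (\<lambda>v. A *v v)"

definition sigma1 :: "complex^2^2 \<Rightarrow> real" where
  "sigma1 A = opnorm A"

definition sigma2 :: "complex^2^2 \<Rightarrow> real" where
  "sigma2 A = cmod (det A) / opnorm A"

fun iter :: "(int \<Rightarrow> complex^2^2) \<Rightarrow> nat \<Rightarrow> int \<Rightarrow> complex^2^2" where
  "iter B 0 j = mat 1"
| "iter B (Suc n) j = B (j + int n) ** iter B n j"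

definition is_line :: "(complex^2) set \<Rightarrow> bool" where
  "is_line V \<longleftrightarrow> vec.subspace V \<and> vec.dim V = 1"

definition cols2 :: "complex^2 \<Rightarrow> complex^2 \<Rightarrow> complex^2^2" where
  "cols2 v w = transpose (vector [v, w])"

text \<open>
  The value does not depend on the spanning unit vectors chosen (lemma \<open>line_dist_eq\<close>),
  so the description below is proper for lines.
\<close>

definition line_dist :: "(complex^2) set \<Rightarrow> (complex^2) set \<Rightarrow> real" where
  "line_dist V W = (THE d. \<exists>v w. norm v = 1 \<and> norm w = 1 \<and>
      vec.span {v} = V \<and> vec.span {w} = W \<and> d = 2 * cmod (det (cols2 v w)))"

lemma det_cols2: "det (cols2 v w) = v $ 1 * w $ 2 - w $ 1 * v $ 2"
  by (simp add: cols2_def det_2 transpose_def)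

lemma norm_smult_vec: "norm (c *s (v :: complex^2)) = cmod c * norm v"
proof -
  have "norm (c *s v) = L2_set (\<lambda>i. cmod c * cmod (v $ i)) UNIV"
    by (simp add: norm_vec_def norm_mult)
  also have "\<dots> = cmod c * norm v"
    by (simp add: norm_vec_def L2_set_right_distrib)
  finally show ?thesis .
qed

lemma unit_span_eq:
  assumes "norm v = 1" "norm (v' :: complex^2) = 1" "vec.span {v} = vec.span {v'}"
  obtains c where "cmod c = 1" "v' = c *s v"
proof -
  have "v' \<in> vec.span {v}"
    using assms(3) vec.span_base[of v' "{v'}"] by simp
  then obtain c where c: "v' = c *s v"
    by (auto simp: vec.span_singleton)
  then have "cmod c = 1"
    using assms by (simp add: norm_smult_vec)
  with c that show thesis by blast
qed

lemma line_dist_eq: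
  assumes "norm v = 1" "norm w = 1" "vec.span {v} = V" "vec.span {w} = W"
  shows "line_dist V W = 2 * cmod (det (cols2 v w))"
  unfolding line_dist_def
proof (rule the_equality)
  show "\<exists>v' w'. norm v' = 1 \<and> norm w' = 1 \<and> vec.span {v'} = V \<and> vec.span {w'} = W \<and>
      2 * cmod (det (cols2 v w)) = 2 * cmod (det (cols2 v' w'))"
    using assms by blast
next
  fix d
  assume "\<exists>v' w'. norm v' = 1 \<and> norm w' = 1 \<and> vec.span {v'} = V \<and> vec.span {w'} = W \<and>
      d = 2 * cmod (det (cols2 v' w'))"
  then obtain v' w' where *: "norm v' = 1" "norm w' = 1" "vec.span {v'} = V" "vec.span {w'} = W"
    "d = 2 * cmod (det (cols2 v' w'))" by blast
  obtain a where a: "cmod a = 1" "v' = a *s v"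
    by (rule unit_span_eq[of v v']) (use assms * in auto)
  obtain b where b: "cmod b = 1" "w' = b *s w"
    by (rule unit_span_eq[of w w']) (use assms * in auto)
  have "det (cols2 v' w') = (a * b) * det (cols2 v w)"
    by (simp add: a b det_cols2 algebra_simps)
  then show "d = 2 * cmod (det (cols2 v w))"
    using a b * by (simp add: norm_mult)
qed

definition dominated_splitting :: "(int \<Rightarrow> complex^2^2) \<Rightarrow> bool" where
  "dominated_splitting B \<longleftrightarrow> (\<exists>Eu Es :: int \<Rightarrow> (complex^2) set.
     (\<forall>j. is_line (Eu j) \<and> is_line (Es j)) \<and>
     (\<forall>j. (\<lambda>v. B j *v v) ` Eu j \<subseteq> Eu (j + 1) \<and> (\<lambda>v. B j *v v) ` Es j \<subseteq> Es (j + 1)) \<and>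
     (INF j. line_dist (Eu j) (Es j)) > 0 \<and>
     (\<exists>(N::nat) (lam::real). N > 0 \<and> lam > 1 \<and>
        (\<forall>j. \<forall>u\<in>Eu j. \<forall>s\<in>Es j. norm u = 1 \<longrightarrow> norm s = 1 \<longrightarrow>
           norm (iter B N j *v u) > lam * norm (iter B N j *v s)) \<and>
        (INF j. opnorm (iter B N j)) > 0))"

text \<open>
  The suprema are taken in \<^typ>\<open>ereal\<close>, so that an unbounded family has supremum \<open>\<infinity>\<close> and
  violates the estimate.
\<close>

definition SVG :: "(int \<Rightarrow> complex^2^2) \<Rightarrow> real \<Rightarrow> real \<Rightarrow> bool" where
  "SVG B C \<mu> \<longleftrightarrow> (\<forall>n j. iter B n j \<noteq> 0) \<and>
     (\<forall>n. Sup (\<Union>j. {ereal (sigma2 (iter B n j) / sigma1 (iter B (n + 1) j)),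
                     ereal (sigma2 (iter B n (j + 1)) / sigma1 (iter B (n + 1) j))})
          < ereal (C * \<mu> powr (- real n)))"

definition FI :: "(int \<Rightarrow> complex^2^2) \<Rightarrow> real \<Rightarrow> real \<Rightarrow> real \<Rightarrow> bool" where
  "FI B C \<mu> \<epsilon> \<longleftrightarrow> (\<forall>n\<ge>1. \<forall>j. iter B n j \<noteq> 0) \<and>
     (\<forall>n\<ge>1. Sup (\<Union>j. {ereal (sigma1 (iter B n j) / sigma1 (iter B (n + 1) j)),
                        ereal (sigma1 (iter B n (j + 1)) / sigma1 (iter B (n + 1) j))})
          < ereal (C * \<mu> powr ((1 - \<epsilon>) * real n)))"

end

theory Submission
  imports Defs
begin

text \<open>
  Suppose first that \<open>B\<close> admits a dominated splitting. Unit vectors in the two lines are multiplied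
  by scalars \<open>a j\<close> (unstable) and \<open>b j\<close> (stable). As the angle between the lines is bounded below,
  \<open>sigma1 (iter B n j)\<close> is of the order of the product of \<open>n\<close> consecutive \<open>a\<close>'s, \<open>sigma2\<close> is at most of
  the order of the product of the \<open>b\<close>'s, and each \<open>a j\<close> is bounded below. So the quotients in
  (SVG) decay exponentially and those in (FI) are bounded.

  Conversely, (SVG) makes the most contracted directions of \<open>iter B n j\<close> converge, for \<open>n\<close> tending to
  infinity, to an invariant direction (\<open>contracted_direction\<close>, \<open>stable_invariant\<close>), which
  \<open>iter B n j\<close> contracts to a fraction of order \<open>\<mu> powr (- n)\<close> of its norm. In orthonormal frames
  that start with this direction, \<open>B j\<close> is upper triangular with diagonal \<open>b j\<close>, \<open>q j\<close> and corner
  \<open>x j\<close>. Three facts about these scalars complete the proof.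

  \<^item> \<open>q\<close> is bounded away from zero (\<open>q_bounded_below\<close>). Prepending \<open>B j\<close> to a long product cannot
    reduce its norm as much as the stable direction is contracted; this is what (FI) says when
    \<open>\<epsilon> > 0\<close>.

  \<^item> Products of \<open>b\<close> are exponentially smaller than products of \<open>q\<close> (\<open>uniform_drop\<close>,
    \<open>uniform_exponential_decay\<close>). Otherwise the corner of the triangular product would grow at most
    linearly relative to its entry \<open>b\<close>, although that entry is an exponentially small part of the norm.

  \<^item> Consequently the unstable line can be found as a graph over the normal direction, whose slope
    solves a contracting linear recursion (\<open>bounded_solution\<close>); a bounded slope is a lower bound on
    the angle.
\<close>

section \<open>The wedge product on the plane\<close>

text \<open>
  For unit vectors the modulus of the wedge is the sine of the angle between the lines that they
  span, hence half of their distance; it is used as the angle throughout.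
\<close>
definition wedge :: "complex^2 \<Rightarrow> complex^2 \<Rightarrow> complex" where
  "wedge v w = v $ 1 * w $ 2 - v $ 2 * w $ 1"

text \<open>
  The conjugations make this the unit normal for the Hermitian product, with
  \<open>wedge v (perp v) = (norm v)\<^sup>2\<close>.
\<close>
definition perp :: "complex^2 \<Rightarrow> complex^2" where
  "perp v = vector [- cnj (v $ 2), cnj (v $ 1)]"

lemma det_cols2_wedge: "det (cols2 v w) = wedge v w"
  by (simp add: det_cols2 wedge_def)

lemma norm_sq: "(norm (v :: complex^2))\<^sup>2 = (cmod (v $ 1))\<^sup>2 + (cmod (v $ 2))\<^sup>2"
  by (simp add: norm_vec_def L2_set_def UNIV_2)

lemma norm_perp [simp]: "norm (perp v) = norm v"
  by (simp add: norm_vec_def L2_set_def UNIV_2 perp_def add.commute)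

lemma wedge_perp: "wedge v (perp v) = of_real ((norm v)\<^sup>2)"
  by (simp add: wedge_def perp_def norm_sq complex_norm_square[symmetric])

lemma wedge_self [simp]: "wedge v v = 0"
  by (simp add: wedge_def)

lemma wedge_commute: "wedge v w = - wedge w v"
  by (simp add: wedge_def)

lemma wedge_simps:
  "wedge (v + v') w = wedge v w + wedge v' w" "wedge v (w + w') = wedge v w + wedge v w'"
  "wedge (c *s v) w = c * wedge v w" "wedge v (c *s w) = c * wedge v w"
  by (simp_all add: wedge_def algebra_simps)

lemma wedge_le: "cmod (wedge v w) \<le> norm v * norm w"
proof -
  let ?a = "cmod (v $ 1)" and ?b = "cmod (v $ 2)" and ?c = "cmod (w $ 1)" and ?d = "cmod (w $ 2)"
  have "cmod (wedge v w) \<le> ?a * ?d + ?b * ?c"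
    unfolding wedge_def by (metis norm_mult norm_triangle_ineq4)
  also have "\<dots> \<le> norm v * norm w"
  proof (rule power2_le_imp_le)
    have "(norm v * norm w)\<^sup>2 = (?a\<^sup>2 + ?b\<^sup>2) * (?c\<^sup>2 + ?d\<^sup>2)"
      by (simp add: power_mult_distrib norm_sq)
    also have "\<dots> = (?a * ?d + ?b * ?c)\<^sup>2 + (?a * ?c - ?b * ?d)\<^sup>2" by algebra
    finally show "(?a * ?d + ?b * ?c)\<^sup>2 \<le> (norm v * norm w)\<^sup>2" by simp
  qed simp
  finally show ?thesis .
qed

text \<open>
  Three vectors in a plane are dependent, and this is the relation. The triangle inequality for
  angles, norm bounds from two directions and expansions in a frame are all instances of it.
\<close>
lemma cramer: "wedge v w *s x = wedge x w *s v + wedge v x *s w"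
  by (simp add: vec_eq_iff forall_2 wedge_def algebra_simps)

lemma wedge_mult: "wedge (A *v v) (A *v w) = det A * wedge v w"
  by (simp add: wedge_def det_2 matrix_vector_mult_def UNIV_2 algebra_simps)

section \<open>Operator norms and directions\<close>

lemma opnorm_bound: "norm (A *v v) \<le> opnorm A * norm v"
  using onorm[OF matrix_vector_mul_bounded_linear[of A], of v] by (simp add: mult.commute)

lemma opnorm_nonneg: "0 \<le> opnorm A"
  by (rule onorm_pos_le) simp

lemma opnorm_mult: "opnorm (A ** A') \<le> opnorm A * opnorm A'"
proof -
  have "(\<lambda>v. (A ** A') *v v) = (\<lambda>v. A *v v) \<circ> (\<lambda>v. A' *v v)"
    by (simp add: fun_eq_iff matrix_vector_mul_assoc)
  then show ?thesis using onorm_compose[OF matrix_vector_mul_bounded_linear[of A] matrix_vector_mul_bounded_linear[of A']] by metis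
qed

lemma opnorm_pos: "A \<noteq> 0 \<Longrightarrow> 0 < opnorm A"
proof -
  assume "A \<noteq> 0"
  then have "\<exists>v. A *v v \<noteq> 0" using matrix_eq[of A 0] by auto
  then show ?thesis using onorm_pos_lt[OF matrix_vector_mul_bounded_linear[of A]] by auto
qed

lemma matrix_smult_vec: "(A :: complex^2^2) *v (c *s v) = c *s (A *v v)"
  by (simp add: vector_scalar_commute)

lemma opnorm_leI: "(\<And>v. norm (A *v v) \<le> b * norm v) \<Longrightarrow> opnorm A \<le> b"
  by (rule onorm_le)

text \<open>
  A matrix that is small on two directions is small, unless the directions are nearly parallel.
  Read backwards: two directions that are both contracted strongly, relative to the norm, are
  nearly parallel. This second reading stands in for singular vectors.
\<close>
lemma wedge_opnorm:
  "cmod (wedge v w) * opnorm A \<le> norm w * norm (A *v v) + norm v * norm (A *v w)"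
proof (cases "wedge v w = 0")
  case False
  let ?b = "norm w * norm (A *v v) + norm v * norm (A *v w)"
  have "opnorm A \<le> ?b / cmod (wedge v w)"
  proof (rule opnorm_leI)
    fix x
    have "cmod (wedge v w) * norm (A *v x) = norm (A *v (wedge v w *s x))"
      by (simp add: matrix_smult_vec norm_smult_vec)
    also have "\<dots> = norm (wedge x w *s (A *v v) + wedge v x *s (A *v w))"
      by (simp add: cramer[of v w x] matrix_vector_right_distrib matrix_smult_vec)
    also have "\<dots> \<le> cmod (wedge x w) * norm (A *v v) + cmod (wedge v x) * norm (A *v w)"
      by (metis norm_smult_vec norm_triangle_ineq)
    also have "\<dots> \<le> (norm x * norm w) * norm (A *v v) + (norm v * norm x) * norm (A *v w)"
      by (intro add_mono mult_right_mono wedge_le) auto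
    also have "\<dots> = ?b * norm x" by (simp add: algebra_simps)
    finally show "norm (A *v x) \<le> ?b / cmod (wedge v w) * norm x"
      using False by (simp add: field_simps)
  qed
  then show ?thesis using False by (simp add: field_simps)
qed simp

lemma wedge_triangle:
  assumes "norm u = 1" "norm v = 1" "norm w = 1"
  shows "cmod (wedge u w) \<le> cmod (wedge u v) + cmod (wedge v w)"
proof -
  have "cmod (wedge u w) = norm (wedge u w *s v)" by (simp add: norm_smult_vec assms)
  also have "\<dots> \<le> norm (wedge v w *s u) + norm (wedge u v *s w)"
    unfolding cramer[of u w v] by (rule norm_triangle_ineq)
  finally show ?thesis by (simp add: norm_smult_vec assms)
qed

lemma frame_expansion:
  assumes "norm s = 1"
  shows "v = wedge v (perp s) *s s + wedge s v *s perp s"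
  using cramer[of s "perp s" v] assms by (simp add: wedge_perp)

lemma norm_apply_close:
  assumes "norm v = 1" "norm w = 1"
  shows "norm (A *v v) \<le> norm (A *v w) + cmod (wedge w v) * opnorm A"
proof -
  have "A *v v = wedge v (perp w) *s (A *v w) + wedge w v *s (A *v perp w)"
    by (subst frame_expansion[OF assms(2), of v])
      (simp add: matrix_vector_right_distrib matrix_smult_vec)
  then have "norm (A *v v) \<le> cmod (wedge v (perp w)) * norm (A *v w)
      + cmod (wedge w v) * norm (A *v perp w)"
    by (metis norm_smult_vec norm_triangle_ineq)
  also have "\<dots> \<le> 1 * norm (A *v w) + cmod (wedge w v) * opnorm A"
    using wedge_le[of v "perp w"] opnorm_bound[of A "perp w"] assms
    by (intro add_mono mult_right_mono mult_left_mono) auto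
  finally show ?thesis by simp
qed

text \<open>
  The right singular vector for \<open>sigma2\<close> would give the constant 1. The constant 2 comes with an
  explicit vector: the one that is annihilated by the larger row of \<open>A\<close>. Its image has a single
  nonzero coordinate, which is the determinant divided by the length of that row.
\<close>
lemma almost_kernel:
  assumes "A \<noteq> 0"
  shows "\<exists>s. norm s = 1 \<and> norm (A *v s) * opnorm A \<le> 2 * cmod (det A)"
proof -
  obtain i where i: "\<And>k. norm (A $ k) \<le> norm (A $ i)"
  proof (cases "norm (A $ 1) \<le> norm (A $ 2)")
    case True
    then have "norm (A $ k) \<le> norm (A $ 2)" for k using exhaust_2[of k] by auto
    then show thesis by (rule that)
  next
    case False
    then have "norm (A $ k) \<le> norm (A $ 1)" for k using exhaust_2[of k] by auto
    then show thesis by (rule that)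
  qed
  let ?r = "A $ i"
  have op: "opnorm A \<le> 2 * norm ?r"
  proof (rule opnorm_leI)
    fix v
    have row: "cmod ((A *v v) $ k) \<le> norm ?r * norm v" for k
    proof -
      have "(A *v v) $ k = wedge (A $ k) (vector [- v $ 2, v $ 1])"
        by (simp add: wedge_def matrix_vector_mult_def UNIV_2)
      moreover have "norm (vector [- v $ 2, v $ 1] :: complex^2) = norm v"
        by (simp add: norm_vec_def L2_set_def UNIV_2 add.commute)
      ultimately have "cmod ((A *v v) $ k) \<le> norm (A $ k) * norm v"
        using wedge_le[of "A $ k" "vector [- v $ 2, v $ 1]"] by simp
      then show ?thesis using i[of k] by (meson mult_right_mono norm_ge_zero order_trans)
    qed
    have "norm (A *v v) \<le> (\<Sum>k\<in>UNIV. cmod ((A *v v) $ k))"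
      unfolding norm_vec_def by (rule L2_set_le_sum) simp
    also have "\<dots> \<le> 2 * norm ?r * norm v" using row[of 1] row[of 2] by (simp add: UNIV_2)
    finally show "norm (A *v v) \<le> 2 * norm ?r * norm v" .
  qed
  have pos: "norm ?r > 0" using opnorm_pos[OF assms] op by linarith
  define t :: "complex^2" where "t = vector [?r $ 2, - ?r $ 1]"
  have nt: "norm t = norm ?r"
    by (simp add: t_def norm_vec_def L2_set_def UNIV_2 add.commute)
  have At: "norm (A *v t) = cmod (det A)"
  proof -
    have "i = 1 \<or> i = 2" by (rule exhaust_2)
    then show ?thesis
    proof
      assume "i = 1"
      then have "A *v t = vector [0, - det A]"
        by (simp add: t_def vec_eq_iff forall_2 matrix_vector_mult_def UNIV_2 det_2 algebra_simps)
      then show ?thesis by (simp add: norm_vec_def L2_set_def UNIV_2)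
    next
      assume "i = 2"
      then have "A *v t = vector [det A, 0]"
        by (simp add: t_def vec_eq_iff forall_2 matrix_vector_mult_def UNIV_2 det_2 algebra_simps)
      then show ?thesis by (simp add: norm_vec_def L2_set_def UNIV_2)
    qed
  qed
  define s where "s = complex_of_real (1 / norm ?r) *s t"
  have "norm s = 1" using pos by (simp add: s_def norm_smult_vec nt norm_divide)
  moreover have "norm (A *v s) = cmod (det A) / norm ?r"
    using pos by (simp add: s_def norm_smult_vec matrix_smult_vec At norm_divide)
  moreover have "cmod (det A) / norm ?r * opnorm A \<le> cmod (det A) / norm ?r * (2 * norm ?r)"
    using op by (intro mult_left_mono) auto
  moreover have "cmod (det A) / norm ?r * (2 * norm ?r) = 2 * cmod (det A)"
    using pos by simp
  ultimately show ?thesis by metis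
qed

section \<open>The limit of the most contracted directions\<close>

text \<open>
  Writing the bound on consecutive angles as \<open>L * (1 - \<theta>) * \<theta> ^ n\<close> makes the sum telescope.
\<close>
lemma geometric_wedge:
  fixes s :: "nat \<Rightarrow> complex^2"
  assumes "\<And>n. norm (s n) = 1" "0 < \<theta>" "\<theta> < 1" "\<And>n. cmod (wedge (s n) (s (Suc n))) \<le> L * (1 - \<theta>) * \<theta> ^ n"
  shows "cmod (wedge (s n) (s (n + k))) \<le> L * (\<theta> ^ n - \<theta> ^ (n + k))"
proof (induction k)
  case (Suc k)
  have "cmod (wedge (s n) (s (n + Suc k))) \<le> cmod (wedge (s n) (s (n + k))) + cmod (wedge (s (n + k)) (s (Suc (n + k))))"
    using wedge_triangle[OF assms(1) assms(1) assms(1)] by simp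
  also have "\<dots> \<le> L * (\<theta> ^ n - \<theta> ^ (n + k)) + L * (1 - \<theta>) * \<theta> ^ (n + k)"
    using Suc assms(4) by (intro add_mono) auto
  also have "\<dots> = L * (\<theta> ^ n - \<theta> ^ (n + Suc k))" by (simp add: algebra_simps)
  finally show ?case .
qed simp

text \<open>
  Let \<open>s n\<close> be almost the most contracted direction of \<open>A n\<close>. The gap makes \<open>A (Suc n)\<close> contract
  both \<open>s n\<close> and \<open>s (Suc n)\<close> to a fraction of order \<open>\<theta> ^ n\<close> of its norm, so these two are nearly
  parallel and the lines converge geometrically. The vectors need not converge, because their
  phases are arbitrary; compactness of the sphere provides a limit vector.
\<close>
lemma contracted_direction:
  fixes A T :: "nat \<Rightarrow> complex^2^2"
  assumes nz: "\<And>n. A n \<noteq> 0" and step: "\<And>n. A (Suc n) = T n ** A n" and T: "\<And>n. opnorm (T n) \<le> M"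
    and M: "M \<ge> 1" and \<theta>: "0 < \<theta>" "\<theta> < 1" and C: "C > 0"
    and gap: "\<And>n. cmod (det (A n)) \<le> C * \<theta> ^ n * opnorm (A n) * opnorm (A (Suc n))"
  shows "\<exists>s. norm s = 1 \<and> (\<forall>n. norm (A n *v s) \<le> (2 * C * M + 4 * C * M / (1 - \<theta>)) * \<theta> ^ n * opnorm (A n))"
proof -
  have pos: "opnorm (A n) > 0" for n by (rule opnorm_pos[OF nz])
  have grow: "opnorm (A (Suc n)) \<le> M * opnorm (A n)" for n
    using opnorm_mult[of "T n" "A n"] mult_right_mono[OF T[of n] opnorm_nonneg[of "A n"]]
    unfolding step by linarith
  obtain s where s: "\<And>n. norm (s n) = 1" "\<And>n. norm (A n *v s n) * opnorm (A n) \<le> 2 * cmod (det (A n))"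
    using almost_kernel[OF nz] by metis
  have As: "norm (A n *v s n) \<le> 2 * C * \<theta> ^ n * opnorm (A (Suc n))" for n
  proof -
    have "norm (A n *v s n) * opnorm (A n) \<le> (2 * C * \<theta> ^ n * opnorm (A (Suc n))) * opnorm (A n)"
      using s(2)[of n] gap[of n] by (simp add: mult_ac)
    then show ?thesis using pos[of n] by simp
  qed
  have As': "norm (A n *v s n) \<le> 2 * C * M * \<theta> ^ n * opnorm (A n)" for n
  proof -
    have "2 * C * \<theta> ^ n * opnorm (A (Suc n)) \<le> 2 * C * \<theta> ^ n * (M * opnorm (A n))"
      using grow C \<theta> by (intro mult_left_mono) auto
    then show ?thesis using As[of n] by (simp add: mult_ac)
  qed
  have consec: "cmod (wedge (s n) (s (Suc n))) \<le> (4 * C * M / (1 - \<theta>)) * (1 - \<theta>) * \<theta> ^ n" for n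
  proof -
    have "norm (A (Suc n) *v s n) = norm (T n *v (A n *v s n))"
      by (simp add: step matrix_vector_mul_assoc)
    also have "\<dots> \<le> M * norm (A n *v s n)"
      using opnorm_bound[of "T n" "A n *v s n"] mult_right_mono[OF T[of n] norm_ge_zero[of "A n *v s n"]] by linarith
    also have "\<dots> \<le> M * (2 * C * \<theta> ^ n * opnorm (A (Suc n)))"
      using As[of n] M by (intro mult_left_mono) auto
    finally have 1: "norm (A (Suc n) *v s n) \<le> 2 * C * M * \<theta> ^ n * opnorm (A (Suc n))" by (simp add: mult_ac)
    have "\<theta> ^ Suc n \<le> \<theta> ^ n" using \<theta> by (intro power_decreasing) auto
    then have "2 * C * M * \<theta> ^ Suc n * opnorm (A (Suc n)) \<le> 2 * C * M * \<theta> ^ n * opnorm (A (Suc n))"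
      using C M opnorm_nonneg by (intro mult_right_mono mult_left_mono) auto
    then have 2: "norm (A (Suc n) *v s (Suc n)) \<le> 2 * C * M * \<theta> ^ n * opnorm (A (Suc n))"
      using As'[of "Suc n"] by linarith
    have "cmod (wedge (s n) (s (Suc n))) * opnorm (A (Suc n)) \<le> (4 * C * M * \<theta> ^ n) * opnorm (A (Suc n))"
      using wedge_opnorm[of "s n" "s (Suc n)" "A (Suc n)"] 1 2 s(1) by simp
    then have "cmod (wedge (s n) (s (Suc n))) \<le> 4 * C * M * \<theta> ^ n" using pos[of "Suc n"] by simp
    then show ?thesis using \<theta> by simp
  qed
  let ?L = "4 * C * M / (1 - \<theta>)"
  let ?K = "2 * C * M + ?L"
  have L: "?L \<ge> 0" using C M \<theta> by simp
  have late: "norm (A n *v s m) \<le> ?K * \<theta> ^ n * opnorm (A n)" if nm: "n \<le> m" for n m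
  proof -
    obtain k where k: "m = n + k" using le_Suc_ex[OF nm] by auto
    have "cmod (wedge (s n) (s m)) \<le> ?L * (\<theta> ^ n - \<theta> ^ m)"
      using geometric_wedge[OF s(1) \<theta> consec, of n k] k by simp
    also have "\<dots> \<le> ?L * \<theta> ^ n" using L \<theta> by (intro mult_left_mono) auto
    finally have "cmod (wedge (s n) (s m)) * opnorm (A n) \<le> ?L * \<theta> ^ n * opnorm (A n)"
      by (rule mult_right_mono) (rule opnorm_nonneg)
    then show ?thesis
      using norm_apply_close[OF s(1)[of m] s(1)[of n], of "A n"] As'[of n] by (simp add: distrib_right)
  qed
  \<comment> \<open>The bound on \<open>A n\<close> holds for all late \<open>s m\<close> and passes to a limit point.\<close>
  have "\<forall>m. s m \<in> sphere 0 1" using s(1) by simp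
  then obtain l r where l: "l \<in> sphere 0 1" and r: "strict_mono r" and lim: "(s \<circ> r) \<longlonglongrightarrow> l"
    using compact_sphere[of "0 :: complex^2" 1] unfolding compact_def by metis
  have "norm (A n *v l) \<le> ?K * \<theta> ^ n * opnorm (A n)" for n
  proof (rule tendsto_upperbound)
    show "(\<lambda>m. norm (A n *v (s \<circ> r) m)) \<longlonglongrightarrow> norm (A n *v l)"
      by (intro tendsto_norm bounded_linear.tendsto[OF matrix_vector_mul_bounded_linear] lim)
    show "\<forall>\<^sub>F m in sequentially. norm (A n *v (s \<circ> r) m) \<le> ?K * \<theta> ^ n * opnorm (A n)"
      unfolding eventually_sequentially comp_def
      using late le_trans[OF _ seq_suble[OF r]] by (intro exI[of _ n] allI impI) auto
  qed simp
  then show ?thesis using l by auto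
qed

section \<open>Products along an orbit\<close>

lemma iter_Suc_right: "iter B (Suc n) j = iter B n (j + 1) ** B j"
proof (induction n)
  case (Suc n)
  have "iter B (Suc (Suc n)) j = B (j + 1 + int n) ** iter B (Suc n) j" by (simp add: add_ac)
  also have "\<dots> = (B (j + 1 + int n) ** iter B n (j + 1)) ** B j"
    unfolding Suc.IH by (rule matrix_mul_assoc)
  finally show ?case by simp
qed simp

definition cocycle :: "(int \<Rightarrow> 'a :: comm_monoid_mult) \<Rightarrow> nat \<Rightarrow> int \<Rightarrow> 'a" where
  "cocycle f n j = (\<Prod>k<n. f (j + int k))"

lemma cocycle_0 [simp]: "cocycle f 0 j = 1"
  and cocycle_Suc: "cocycle f (Suc n) j = f (j + int n) * cocycle f n j"
  by (simp_all add: cocycle_def mult.commute)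

lemma cocycle_add: "cocycle f (m + n) j = cocycle f m j * cocycle f n (j + int m)"
  by (induction n) (simp_all add: cocycle_Suc mult_ac add_ac)

lemma cocycle_Suc_right: "cocycle f (Suc n) j = cocycle f n (j + 1) * f j"
  using cocycle_add[of f 1 n j] by (simp add: cocycle_def mult.commute)

lemma cmod_cocycle: "cmod (cocycle f n j) = cocycle (\<lambda>i. cmod (f i)) n j"
  by (simp add: cocycle_def prod_norm)

lemma cocycle_divide: "cocycle (\<lambda>i. f i / g i :: 'a :: field) n j = cocycle f n j / cocycle g n j"
  by (simp add: cocycle_def prod_dividef)

lemma cocycle_nonneg: "(\<And>i. 0 \<le> f i) \<Longrightarrow> 0 \<le> (cocycle f n j :: real)"
  by (simp add: cocycle_def prod_nonneg)

lemma cocycle_le: "(\<And>i. 0 \<le> f i) \<Longrightarrow> (\<And>i. f i \<le> M) \<Longrightarrow> cocycle f n j \<le> (M :: real) ^ n"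
  unfolding cocycle_def using prod_mono[of "{..<n}" "\<lambda>k. f (j + int k)" "\<lambda>_. M"] by simp

lemma cocycle_ge: "0 \<le> c \<Longrightarrow> (\<And>i. c \<le> f i) \<Longrightarrow> (c :: real) ^ n \<le> cocycle f n j"
  unfolding cocycle_def using prod_mono[of "{..<n}" "\<lambda>_. c" "\<lambda>k. f (j + int k)"] by simp

lemma iter_eigen:
  assumes "\<And>j. B j *v v j = a j *s v (j + 1)"
  shows "iter B n j *v v j = cocycle a n j *s v (j + int n)"
proof (induction n)
  case (Suc n)
  have "iter B (Suc n) j *v v j = B (j + int n) *v (iter B n j *v v j)"
    by (simp add: matrix_vector_mul_assoc)
  also have "\<dots> = cocycle a (Suc n) j *s v (j + int (Suc n))"
    by (simp add: Suc matrix_smult_vec assms cocycle_Suc mult_ac add_ac)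
  finally show ?case .
qed simp

section \<open>Decay and recursions for scalar cocycles\<close>

text \<open>
  Starting at any place, cut the product into blocks of length at most \<open>N\<close>, each contributing a
  factor at most \<open>\<tau>\<close>; this gives the rate \<open>\<tau>\<close> to the power \<open>1 / N\<close>, and the incomplete last
  block goes into the constant.
\<close>
lemma uniform_exponential_decay:
  fixes \<rho> :: "int \<Rightarrow> real"
  assumes nonneg: "\<And>i. 0 \<le> \<rho> i" and bound: "\<And>i. \<rho> i \<le> R" and \<tau>: "0 < \<tau>" "\<tau> < 1"
    and drop: "\<And>i. \<exists>k\<in>{1..N}. cocycle \<rho> k i \<le> \<tau>"
  shows "\<exists>K \<theta>. 1 \<le> K \<and> 0 < \<theta> \<and> \<theta> < 1 \<and> (\<forall>n i. cocycle \<rho> n i \<le> K * \<theta> ^ n)"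
proof -
  have N: "N \<ge> 1" using drop[of 0] by force
  define \<theta> where "\<theta> = root N \<tau>"
  define S where "S = max R 1"
  define K where "K = S ^ N / \<tau>"
  have \<theta>: "0 < \<theta>" "\<theta> < 1" and \<theta>N: "\<theta> ^ N = \<tau>"
    using N \<tau> by (simp_all add: \<theta>_def)
  have S: "S \<ge> 1" and Sb: "\<rho> i \<le> S" for i using bound[of i] by (auto simp: S_def)
  have SN: "S ^ N \<ge> 1" using S by simp
  have K: "K \<ge> 1" unfolding K_def using SN \<tau> by (simp add: field_simps)
  have "cocycle \<rho> n i \<le> K * \<theta> ^ n" for n i
  proof (induction n arbitrary: i rule: less_induct)
    case (less n)
    show ?case
    proof (cases "n < N")
      case True
      have "cocycle \<rho> n i \<le> S ^ n" by (rule cocycle_le[OF nonneg Sb])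
      also have "\<dots> \<le> S ^ N" using S True by (intro power_increasing) auto
      also have "\<dots> = K * \<theta> ^ N" using \<tau> by (simp add: K_def \<theta>N)
      also have "\<dots> \<le> K * \<theta> ^ n" using K \<theta> True by (intro mult_left_mono power_decreasing) auto
      finally show ?thesis .
    next
      case False
      obtain k where k: "1 \<le> k" "k \<le> N" "cocycle \<rho> k i \<le> \<tau>" using drop[of i] by auto
      have "cocycle \<rho> n i = cocycle \<rho> k i * cocycle \<rho> (n - k) (i + int k)"
        using cocycle_add[of \<rho> k "n - k" i] k False by simp
      also have "\<dots> \<le> \<theta> ^ k * (K * \<theta> ^ (n - k))"
      proof (rule mult_mono)
        have "\<theta> ^ N \<le> \<theta> ^ k" using \<theta> k by (intro power_decreasing) auto
        then show "cocycle \<rho> k i \<le> \<theta> ^ k" using k \<theta>N by simp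
        show "cocycle \<rho> (n - k) (i + int k) \<le> K * \<theta> ^ (n - k)" using less k False by simp
      qed (use \<theta> nonneg in \<open>auto intro: cocycle_nonneg\<close>)
      also have "\<dots> = K * \<theta> ^ n" using k False by (simp add: power_add[symmetric])
      finally show ?thesis .
    qed
  qed
  then show ?thesis using K \<theta> by blast
qed

lemma cocycle_shift_back: "cocycle f (Suc k) (j + 1 - int (Suc k)) = f j * cocycle f k (j - int k)"
  by (simp add: cocycle_Suc algebra_simps)

text \<open>
  The solution sums the contributions of the whole past:
  \<open>h j = g (j - 1) + \<rho> (j - 1) * g (j - 2) + \<rho> (j - 1) * \<rho> (j - 2) * g (j - 3) + \<dots>\<close>.
\<close>
lemma bounded_solution:
  fixes \<rho> g :: "int \<Rightarrow> complex"
  assumes \<theta>: "0 < \<theta>" "\<theta> < 1" and decay: "\<And>n i. cmod (cocycle \<rho> n i) \<le> K * \<theta> ^ n"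
    and g: "\<And>i. cmod (g i) \<le> G"
  shows "\<exists>h H. (\<forall>j. h (j + 1) = \<rho> j * h j + g j) \<and> (\<forall>j. cmod (h j) \<le> H)"
proof -
  define t where "t j k = cocycle \<rho> k (j - int k) * g (j - 1 - int k)" for j :: int and k :: nat
  define h where "h j = (\<Sum>k. t j k)" for j
  have bnd: "cmod (t j k) \<le> K * G * \<theta> ^ k" for j k
  proof -
    have "0 \<le> K * \<theta> ^ k" using decay[of k j] norm_ge_zero order_trans by blast
    then have "cmod (t j k) \<le> (K * \<theta> ^ k) * G"
      unfolding t_def norm_mult by (intro mult_mono decay g) auto
    then show ?thesis by (simp add: mult_ac)
  qed
  have geo: "summable (\<lambda>k. K * G * \<theta> ^ k)"
    using \<theta> by (intro summable_mult summable_geometric) auto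
  have sm: "summable (\<lambda>k. cmod (t j k))" for j
    using bnd by (intro summable_comparison_test'[OF geo, of 0]) auto
  have "h (j + 1) = \<rho> j * h j + g j" for j
  proof -
    have "t (j + 1) (Suc k) = \<rho> j * t j k" for k
      using cocycle_shift_back[of \<rho> k j] by (simp add: t_def algebra_simps)
    then have "(\<Sum>k. \<rho> j * t j k) = h (j + 1) - t (j + 1) 0"
      using suminf_split_head[OF summable_norm_cancel[OF sm[of "j + 1"]]] by (simp add: h_def)
    then show ?thesis
      using suminf_mult[OF summable_norm_cancel[OF sm[of j]], of "\<rho> j"]
      by (simp add: h_def t_def eq_diff_eq diff_eq_eq)
  qed
  moreover have "cmod (h j) \<le> (\<Sum>k. K * G * \<theta> ^ k)" for j
  proof -
    have "cmod (h j) \<le> (\<Sum>k. cmod (t j k))" unfolding h_def by (rule summable_norm[OF sm])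
    also have "\<dots> \<le> (\<Sum>k. K * G * \<theta> ^ k)" by (rule suminf_le[OF bnd sm geo])
    finally show ?thesis .
  qed
  ultimately show ?thesis by blast
qed

section \<open>Dominated splitting in terms of multipliers\<close>

lemma is_line_span: assumes "norm v = 1" shows "is_line (vec.span {v})"
proof -
  have "v \<noteq> 0" using assms by auto
  then have "vec.independent {v}" by (simp add: vec.dependent_single)
  then show ?thesis unfolding is_line_def using vec.dim_eq_card_independent[of "{v}"]
    by (simp add: vec.subspace_span)
qed

lemma is_line_unit: assumes "is_line V" shows "\<exists>v. norm v = 1 \<and> vec.span {v} = V"
proof -
  have V: "vec.subspace V" "vec.dim V = 1" using assms by (auto simp: is_line_def)
  obtain b where b: "b \<subseteq> V" "vec.independent b" "V \<subseteq> vec.span b" "card b = 1"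
    using vec.basis_exists[of V] V by metis
  obtain w where w: "b = {w}" using b(4) card_1_singletonE by metis
  have "w \<noteq> 0" using b w vec.dependent_single by auto
  then have nw: "norm w > 0" by simp
  have V': "V = vec.span {w}" using b w V by (metis vec.span_minimal subset_antisym)
  define v where "v = complex_of_real (1 / norm w) *s w"
  have wv: "w = complex_of_real (norm w) *s v" using nw by (simp add: v_def)
  have "norm v = 1" using nw by (simp add: v_def norm_smult_vec norm_divide)
  moreover have "vec.span {v} = V"
  proof
    show "vec.span {v} \<subseteq> V" unfolding V'
      by (rule vec.span_minimal) (auto simp: v_def intro: vec.span_scale vec.span_base vec.subspace_span)
    show "V \<subseteq> vec.span {v}" unfolding V'
      by (rule vec.span_minimal) (use wv in \<open>metis empty_subsetI insert_subset vec.span_scale vec.span_base singletonI\<close>, rule vec.subspace_span)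
  qed
  ultimately show ?thesis by blast
qed

text \<open>
  A splitting in coordinates: with unit vectors \<open>u j\<close> and \<open>s j\<close> spanning \<open>E\<^sup>u(j)\<close> and \<open>E\<^sup>s(j)\<close>,
  invariance says that \<open>B\<close> acts on them by scalars \<open>a j\<close> and \<open>b j\<close>. The lower bound on the
  norm of the \<open>N\<close>-step products becomes a lower bound on the \<open>N\<close>-step multiplier of \<open>u\<close>.
\<close>
definition has_multipliers ::
  "(int \<Rightarrow> complex^2^2) \<Rightarrow> (int \<Rightarrow> complex^2) \<Rightarrow> (int \<Rightarrow> complex^2) \<Rightarrow> (int \<Rightarrow> complex) \<Rightarrow> (int \<Rightarrow> complex)
    \<Rightarrow> real \<Rightarrow> nat \<Rightarrow> real \<Rightarrow> real \<Rightarrow> bool" where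
  "has_multipliers B u s a b \<eta> N \<gamma> \<kappa> \<longleftrightarrow>
     (\<forall>j. norm (u j) = 1) \<and> (\<forall>j. norm (s j) = 1) \<and>
     (\<forall>j. B j *v u j = a j *s u (j + 1)) \<and> (\<forall>j. B j *v s j = b j *s s (j + 1)) \<and>
     0 < \<eta> \<and> (\<forall>j. \<eta> \<le> cmod (wedge (u j) (s j))) \<and>
     0 < N \<and> 1 < \<gamma> \<and> (\<forall>j. \<gamma> * cmod (cocycle b N j) < cmod (cocycle a N j)) \<and>
     0 < \<kappa> \<and> (\<forall>j. \<kappa> \<le> cmod (cocycle a N j))"

text \<open>
  The bound that changes its form is the one on the norm of \<open>iter B N j\<close>: as the angle between the
  two lines is bounded below, this norm is comparable to the larger of the two multipliers, which is
  the one of \<open>u\<close>.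
\<close>
lemma dominated_splitting_iff_multipliers:
  "dominated_splitting B \<longleftrightarrow> (\<exists>u s a b \<eta> N \<gamma> \<kappa>. has_multipliers B u s a b \<eta> N \<gamma> \<kappa>)" (is "_ \<longleftrightarrow> ?R")
proof
  assume "dominated_splitting B"
  then obtain Eu Es N \<gamma> where D: "\<forall>j. is_line (Eu j) \<and> is_line (Es j)"
      "\<forall>j. (\<lambda>v. B j *v v) ` Eu j \<subseteq> Eu (j + 1) \<and> (\<lambda>v. B j *v v) ` Es j \<subseteq> Es (j + 1)"
      "\<forall>j. \<forall>u\<in>Eu j. \<forall>s\<in>Es j. norm u = 1 \<longrightarrow> norm s = 1 \<longrightarrow>
           norm (iter B N j *v u) > \<gamma> * norm (iter B N j *v s)"
    and sep: "(INF j. line_dist (Eu j) (Es j)) > 0" and N: "N > 0" "\<gamma> > 1"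
    and big: "(INF j. opnorm (iter B N j)) > 0"
    unfolding dominated_splitting_def by (elim exE conjE) (rule that)
  have lines: "is_line (Eu j)" "is_line (Es j)" for j using D(1) by simp_all
  have inv: "v \<in> Eu j \<Longrightarrow> B j *v v \<in> Eu (j + 1)" "v \<in> Es j \<Longrightarrow> B j *v v \<in> Es (j + 1)" for j v
    using D(2) by (simp_all add: image_subset_iff)
  obtain u where u: "\<And>j. norm (u j) = 1" "\<And>j. vec.span {u j} = Eu j"
    using is_line_unit[OF lines(1)] by metis
  obtain s where s: "\<And>j. norm (s j) = 1" "\<And>j. vec.span {s j} = Es j"
    using is_line_unit[OF lines(2)] by metis
  have uE: "u j \<in> Eu j" and sE: "s j \<in> Es j" for j
    using vec.span_base[of "u j" "{u j}"] vec.span_base[of "s j" "{s j}"] u(2)[of j] s(2)[of j] by simp_all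
  have "B j *v u j \<in> vec.span {u (j + 1)}" "B j *v s j \<in> vec.span {s (j + 1)}" for j
    using inv(1)[OF uE] inv(2)[OF sE] by (simp_all add: u s)
  then have "\<exists>c. B j *v u j = c *s u (j + 1)" "\<exists>c. B j *v s j = c *s s (j + 1)" for j
    unfolding vec.span_singleton by blast+
  then obtain a b where a: "B j *v u j = a j *s u (j + 1)" and b: "B j *v s j = b j *s s (j + 1)" for j
    by metis
  have na: "norm (iter B N j *v u j) = cmod (cocycle a N j)"
    and nb: "norm (iter B N j *v s j) = cmod (cocycle b N j)" for j
    using iter_eigen[of B u a N j] iter_eigen[of B s b N j] a b u(1) s(1) by (simp_all add: norm_smult_vec)
  define \<eta> where "\<eta> = (INF j. line_dist (Eu j) (Es j)) / 2"
  define \<kappa> where "\<kappa> = (INF j. opnorm (iter B N j))"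
  have ld: "line_dist (Eu j) (Es j) = 2 * cmod (wedge (u j) (s j))" for j
    using line_dist_eq[OF u(1) s(1) u(2) s(2)] by (simp add: det_cols2_wedge)
  have \<eta>: "\<eta> \<le> cmod (wedge (u j) (s j))" for j
  proof -
    have "(INF j. line_dist (Eu j) (Es j)) \<le> line_dist (Eu j) (Es j)"
      by (rule cINF_lower) (auto simp: ld intro!: bdd_belowI2[of _ 0])
    then show ?thesis by (simp add: \<eta>_def ld)
  qed
  have \<kappa>: "\<kappa> \<le> opnorm (iter B N j)" for j
    unfolding \<kappa>_def by (rule cINF_lower) (auto intro!: bdd_belowI2[of _ 0] opnorm_nonneg)
  have \<eta>0: "\<eta> > 0" and \<kappa>0: "\<kappa> > 0" using sep big by (simp_all add: \<eta>_def \<kappa>_def)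
  have dom': "\<gamma> * cmod (cocycle b N j) < cmod (cocycle a N j)" for j
    using D(3) uE[of j] sE[of j] u(1)[of j] s(1)[of j] by (simp flip: na nb)
  have "\<eta> * \<kappa> / 2 \<le> cmod (cocycle a N j)" for j
  proof -
    have "\<eta> * \<kappa> \<le> cmod (wedge (u j) (s j)) * opnorm (iter B N j)"
      using \<eta> \<kappa> \<eta>0 \<kappa>0 by (intro mult_mono) auto
    also have "\<dots> \<le> cmod (cocycle a N j) + cmod (cocycle b N j)"
      using wedge_opnorm[of "u j" "s j" "iter B N j"] by (simp add: na nb u(1) s(1))
    also have "\<dots> \<le> 2 * cmod (cocycle a N j)"
      using dom'[of j] mult_right_mono[of 1 \<gamma> "cmod (cocycle b N j)"] N by simp
    finally show ?thesis by simp
  qed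
  moreover have "\<eta> * \<kappa> / 2 > 0" using \<eta>0 \<kappa>0 by simp
  ultimately have "has_multipliers B u s a b \<eta> N \<gamma> (\<eta> * \<kappa> / 2)"
    unfolding has_multipliers_def using u(1) s(1) a b \<eta> \<eta>0 N dom' by simp
  then show ?R by blast
next
  assume ?R
  then obtain u s a b \<eta> N \<gamma> \<kappa> where "has_multipliers B u s a b \<eta> N \<gamma> \<kappa>" by blast
  then have u: "norm (u j) = 1" and s: "norm (s j) = 1"
    and a: "B j *v u j = a j *s u (j + 1)" and b: "B j *v s j = b j *s s (j + 1)"
    and \<eta>: "0 < \<eta>" "\<eta> \<le> cmod (wedge (u j) (s j))" and N: "0 < N" "1 < \<gamma>"
    and dom: "\<gamma> * cmod (cocycle b N j) < cmod (cocycle a N j)"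
    and \<kappa>: "0 < \<kappa>" "\<kappa> \<le> cmod (cocycle a N j)" for j
    by (simp_all add: has_multipliers_def)
  have na: "norm (iter B N j *v u j) = cmod (cocycle a N j)"
    and nb: "norm (iter B N j *v s j) = cmod (cocycle b N j)" for j
    using iter_eigen[of B u a N j] iter_eigen[of B s b N j] a b u s by (simp_all add: norm_smult_vec)
  define Eu where "Eu j = vec.span {u j}" for j
  define Es where "Es j = vec.span {s j}" for j
  have inv: "(\<lambda>v. B j *v v) ` Eu j \<subseteq> Eu (j + 1)" "(\<lambda>v. B j *v v) ` Es j \<subseteq> Es (j + 1)" for j
    by (auto simp: Eu_def Es_def vec.span_singleton matrix_smult_vec a b)
  have sep: "2 * \<eta> \<le> (INF j. line_dist (Eu j) (Es j))"
  proof (rule cINF_greatest)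
    fix j
    show "2 * \<eta> \<le> line_dist (Eu j) (Es j)"
      using line_dist_eq[OF u s Eu_def[symmetric] Es_def[symmetric]] \<eta>(2)[of j] by (simp add: det_cols2_wedge)
  qed simp
  have dom': "\<gamma> * norm (iter B N j *v s') < norm (iter B N j *v u')"
    if that': "u' \<in> Eu j" "s' \<in> Es j" "norm u' = 1" "norm s' = 1" for j u' s'
  proof -
    obtain c d where c: "u' = c *s u j" "s' = d *s s j"
      using that' by (auto simp: Eu_def Es_def vec.span_singleton)
    then have "cmod c = 1" "cmod d = 1" using that'(3,4) u s by (auto simp: norm_smult_vec)
    then show ?thesis using dom[of j] by (simp add: c matrix_smult_vec norm_smult_vec na nb)
  qed
  have big: "\<kappa> \<le> (INF j. opnorm (iter B N j))"
  proof (rule cINF_greatest)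
    fix j
    show "\<kappa> \<le> opnorm (iter B N j)"
      using opnorm_bound[of "iter B N j" "u j"] \<kappa>(2)[of j] by (simp add: na u)
  qed simp
  have "\<forall>j. is_line (Eu j) \<and> is_line (Es j)"
    using is_line_span u s by (simp add: Eu_def Es_def)
  then show "dominated_splitting B"
    unfolding dominated_splitting_def
    using inv sep big \<eta>(1) \<kappa>(1) N dom' by (intro exI[of _ Eu] exI[of _ Es] conjI exI[of _ N] exI[of _ \<gamma>]) auto
qed

section \<open>From dominated splitting to the growth conditions\<close>

lemma opnorm_iter_eigen_ge:
  assumes "\<And>j. norm (u j) = 1" "\<And>j. B j *v u j = a j *s u (j + 1)"
  shows "cmod (cocycle a n j) \<le> opnorm (iter B n j)"
  using opnorm_bound[of "iter B n j" "u j"] iter_eigen[of B u a n j] assms by (simp add: norm_smult_vec)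

text \<open>
  Since the angle is bounded below, \<open>sigma1\<close> of a product is comparable to the multiplier along \<open>u\<close>
  and \<open>sigma2\<close> is at most of the order of the multiplier along \<open>s\<close> (divide the determinant by
  \<open>sigma1\<close>). One step changes the multiplier along \<open>u\<close> by a bounded factor, so the quotients in (FI)
  are bounded, and those in (SVG) decay like the quotient of the two multipliers. Bounded quotients
  are (FI) with \<open>\<epsilon> = 1\<close>, which is less than \<open>\<mu>\<close>.
\<close>
lemma SVG_FI_if_dominated_splitting:
  assumes bounded: "\<And>j. opnorm (B j) \<le> M" and M: "1 \<le> M" and ds: "dominated_splitting B"
  shows "\<exists>C \<mu>. 0 < C \<and> 1 < \<mu> \<and> SVG B C \<mu> \<and> FI B C \<mu> 1"
proof -
  obtain u s a b \<eta> N \<gamma> \<kappa> where "has_multipliers B u s a b \<eta> N \<gamma> \<kappa>"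
    using ds unfolding dominated_splitting_iff_multipliers by blast
  then have u: "norm (u j) = 1" and s: "norm (s j) = 1"
    and a: "B j *v u j = a j *s u (j + 1)" and b: "B j *v s j = b j *s s (j + 1)"
    and \<eta>: "0 < \<eta>" "\<eta> \<le> cmod (wedge (u j) (s j))" and N: "0 < N" "1 < \<gamma>"
    and dom: "\<gamma> * cmod (cocycle b N j) < cmod (cocycle a N j)"
    and \<kappa>: "0 < \<kappa>" "\<kappa> \<le> cmod (cocycle a N j)" for j
    by (simp_all add: has_multipliers_def)
  have aM: "cmod (a j) \<le> M" and bM: "cmod (b j) \<le> M" for j
    using opnorm_bound[of "B j" "u j"] opnorm_bound[of "B j" "s j"] bounded[of j]
    by (simp_all add: a b u s norm_smult_vec)
  \<comment> \<open>The product of \<open>N\<close> consecutive multipliers is at least \<open>\<kappa>\<close> and the other factors are at most \<open>M\<close>,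
    so a single one is at least \<open>c\<close>.\<close>
  define c where "c = \<kappa> / M ^ (N - 1)"
  have c: "c > 0" using \<kappa> M by (simp add: c_def)
  have ac: "c \<le> cmod (a j)" for j
  proof -
    have "\<kappa> \<le> cmod (cocycle a (N - 1) (j + 1)) * cmod (a j)"
      using \<kappa>(2)[of j] cocycle_Suc_right[of a "N - 1" j] N by (simp add: norm_mult)
    also have "\<dots> \<le> M ^ (N - 1) * cmod (a j)"
      unfolding cmod_cocycle by (intro mult_right_mono cocycle_le aM) auto
    finally show ?thesis using M by (simp add: c_def field_simps)
  qed
  have a0: "a j \<noteq> 0" for j using ac[of j] c by auto
  define \<rho> where "\<rho> i = cmod (b i) / cmod (a i)" for i
  have ca: "cmod (cocycle a n j) > 0" for n j
    using a0 by (simp add: cocycle_def)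
  have \<rho>coc: "cocycle \<rho> n j = cmod (cocycle b n j) / cmod (cocycle a n j)" for n j
    unfolding \<rho>_def cocycle_divide cmod_cocycle ..
  have "\<exists>K \<theta>. 1 \<le> K \<and> 0 < \<theta> \<and> \<theta> < 1 \<and> (\<forall>n i. cocycle \<rho> n i \<le> K * \<theta> ^ n)"
  proof (rule uniform_exponential_decay[where \<tau> = "1 / \<gamma>" and R = "M / c" and N = N])
    show "\<rho> i \<le> M / c" for i unfolding \<rho>_def using M bM ac c by (intro frac_le) auto
    show "\<exists>k\<in>{1..N}. cocycle \<rho> k i \<le> 1 / \<gamma>" for i
    proof
      show "cocycle \<rho> N i \<le> 1 / \<gamma>"
        unfolding \<rho>coc using dom[of i] ca[of N i] N by (simp add: field_simps)
    qed (use N in auto)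
  qed (use N in \<open>auto simp: \<rho>_def\<close>)
  then obtain K \<theta> where K: "1 \<le> K" and \<theta>: "0 < \<theta>" "\<theta> < 1" and decay: "\<And>n i. cocycle \<rho> n i \<le> K * \<theta> ^ n" by blast
  have decay': "cmod (cocycle b n j) \<le> K * \<theta> ^ n * cmod (cocycle a n j)" for n j
    using decay[of n j] ca[of n j] unfolding \<rho>coc by (simp add: field_simps)
  have lower: "cmod (cocycle a n j) \<le> opnorm (iter B n j)" for n j
    by (rule opnorm_iter_eigen_ge[where u = u]) (simp_all add: u a)
  have pos: "opnorm (iter B n j) > 0" for n j using lower[of n j] ca[of n j] by linarith
  have next1: "c * cmod (cocycle a n j) \<le> opnorm (iter B (n + 1) j)" for n j
    using lower[of "Suc n" j] mult_right_mono[OF ac[of "j + int n"], of "cmod (cocycle a n j)"]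
    by (simp add: cocycle_Suc norm_mult)
  have next2: "c * cmod (cocycle a n (j + 1)) \<le> opnorm (iter B (n + 1) j)" for n j
    using lower[of "Suc n" j] mult_right_mono[OF ac[of j], of "cmod (cocycle a n (j + 1))"]
    by (simp add: cocycle_Suc_right norm_mult mult.commute)
  have sig1: "sigma1 (iter B n j) \<le> (1 + K) / \<eta> * cmod (cocycle a n j)" for n j
  proof -
    have "\<eta> * opnorm (iter B n j) \<le> cmod (wedge (u j) (s j)) * opnorm (iter B n j)"
      using \<eta>(2) opnorm_nonneg by (intro mult_right_mono) auto
    also have "\<dots> \<le> cmod (cocycle a n j) + cmod (cocycle b n j)"
      using wedge_opnorm[of "u j" "s j" "iter B n j"] iter_eigen[of B u a n j] iter_eigen[of B s b n j]
      by (simp add: a b u s norm_smult_vec)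
    also have "\<dots> \<le> cmod (cocycle a n j) + K * cmod (cocycle a n j)"
    proof -
      have "K * \<theta> ^ n * cmod (cocycle a n j) \<le> K * 1 * cmod (cocycle a n j)"
        using K \<theta> power_le_one[of \<theta> n] by (intro mult_right_mono mult_left_mono) auto
      then show ?thesis using decay'[of n j] by simp
    qed
    finally have "opnorm (iter B n j) \<le> ((1 + K) * cmod (cocycle a n j)) / \<eta>"
      using \<eta>(1) by (simp add: pos_le_divide_eq algebra_simps)
    then show ?thesis by (simp add: sigma1_def)
  qed
  have sig2: "sigma2 (iter B n j) \<le> K / \<eta> * \<theta> ^ n * cmod (cocycle a n j)" for n j
  proof -
    \<comment> \<open>The determinant is the factor by which the wedge of \<open>u j\<close> and \<open>s j\<close> is scaled.\<close>
    have "cmod (det (iter B n j)) * \<eta> \<le> cmod (det (iter B n j)) * cmod (wedge (u j) (s j))"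
      using \<eta>(2) by (intro mult_left_mono) auto
    also have "\<dots> = cmod (wedge (iter B n j *v u j) (iter B n j *v s j))"
      by (simp add: wedge_mult norm_mult)
    also have "\<dots> = cmod (cocycle a n j) * cmod (cocycle b n j) * cmod (wedge (u (j + int n)) (s (j + int n)))"
      using iter_eigen[of B u a n j] iter_eigen[of B s b n j] by (simp add: a b wedge_simps norm_mult)
    also have "\<dots> \<le> cmod (cocycle a n j) * cmod (cocycle b n j) * 1"
      using wedge_le[of "u (j + int n)" "s (j + int n)"] by (intro mult_left_mono) (auto simp: u s)
    also have "\<dots> \<le> opnorm (iter B n j) * (K * \<theta> ^ n * cmod (cocycle a n j))"
      using lower decay' opnorm_nonneg by (simp only: mult_1_right) (intro mult_mono, auto)
    finally show ?thesis unfolding sigma2_def using pos[of n j] \<eta>(1) by (simp add: field_simps)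
  qed
  define C0 where "C0 = (1 + K) / (\<eta> * c)"
  have C0: "C0 > 0" using K \<eta> c by (simp add: C0_def)
  have scaled: "x / sigma1 (iter B (n + 1) j) \<le> r / c"
    if x: "x \<le> r * y" and y: "c * y \<le> opnorm (iter B (n + 1) j)" and r: "0 \<le> r" for x y r n j
  proof -
    have "x \<le> (r / c) * (c * y)" using x c by simp
    also have "\<dots> \<le> (r / c) * opnorm (iter B (n + 1) j)" using y r c by (intro mult_left_mono) auto
    finally show ?thesis using pos[of "n + 1" j] unfolding sigma1_def by (simp add: pos_divide_le_eq)
  qed
  have svg: "sigma2 (iter B n j') / sigma1 (iter B (n + 1) j) \<le> C0 * \<theta> ^ n" if "j' = j \<or> j' = j + 1" for n j j'
  proof -
    have "sigma2 (iter B n j') / sigma1 (iter B (n + 1) j) \<le> (K / \<eta> * \<theta> ^ n) / c"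
      by (rule scaled[OF sig2]) (use that next1 next2 K \<eta> \<theta> in auto)
    also have "\<dots> \<le> C0 * \<theta> ^ n" using K \<eta> c \<theta> by (simp add: C0_def field_simps)
    finally show ?thesis .
  qed
  have fi: "sigma1 (iter B n j') / sigma1 (iter B (n + 1) j) \<le> C0" if "j' = j \<or> j' = j + 1" for n j j'
  proof -
    have "sigma1 (iter B n j') / sigma1 (iter B (n + 1) j) \<le> ((1 + K) / \<eta>) / c"
      by (rule scaled[OF sig1]) (use that next1 next2 K \<eta> in auto)
    also have "\<dots> = C0" by (simp add: C0_def)
    finally show ?thesis .
  qed
  have nz: "iter B n j \<noteq> 0" for n j
    using pos[of n j] by (auto simp: onorm_zero)
  define \<mu> where "\<mu> = 1 / \<theta>"
  have \<mu>: "\<mu> > 1" using \<theta> by (simp add: \<mu>_def)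
  have \<mu>p: "\<mu> powr (- real n) = \<theta> ^ n" for n
    using \<theta> by (simp add: \<mu>_def powr_minus powr_realpow power_one_over)
  \<comment> \<open>The constant is enlarged because the conditions ask for strict bounds on the suprema.\<close>
  have "SVG B (C0 + 1) \<mu>" unfolding SVG_def
  proof (intro conjI allI)
    fix n
    have "Sup (\<Union>j. {ereal (sigma2 (iter B n j) / sigma1 (iter B (n + 1) j)),
        ereal (sigma2 (iter B n (j + 1)) / sigma1 (iter B (n + 1) j))}) \<le> ereal (C0 * \<theta> ^ n)"
      using svg by (intro Sup_least) auto
    also have "\<dots> < ereal ((C0 + 1) * \<mu> powr (- real n))" using \<theta> by (simp add: \<mu>p)
    finally show "Sup (\<Union>j. {ereal (sigma2 (iter B n j) / sigma1 (iter B (n + 1) j)),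
        ereal (sigma2 (iter B n (j + 1)) / sigma1 (iter B (n + 1) j))}) < \<dots>" .
  qed (rule nz)
  moreover have "FI B (C0 + 1) \<mu> 1" unfolding FI_def
  proof (intro conjI allI impI)
    fix n :: nat
    have "Sup (\<Union>j. {ereal (sigma1 (iter B n j) / sigma1 (iter B (n + 1) j)),
        ereal (sigma1 (iter B n (j + 1)) / sigma1 (iter B (n + 1) j))}) \<le> ereal C0"
      using fi by (intro Sup_least) auto
    also have "\<dots> < ereal ((C0 + 1) * \<mu> powr ((1 - 1) * real n))" using \<mu> by simp
    finally show "Sup (\<Union>j. {ereal (sigma1 (iter B n j) / sigma1 (iter B (n + 1) j)),
        ereal (sigma1 (iter B n (j + 1)) / sigma1 (iter B (n + 1) j))}) < \<dots>" .
  qed (rule nz)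
  ultimately show ?thesis using C0 \<mu> by (intro exI[of _ "C0 + 1"] exI[of _ \<mu>]) auto
qed

section \<open>From the growth conditions to dominated splitting\<close>

text \<open>
  Two inequalities from the growth conditions, with \<open>\<theta> = 1 / \<mu>\<close> and \<open>\<phi> = \<mu> powr (1 - \<epsilon>)\<close>, cleared of denominators.
  Then \<open>\<phi> * \<theta> = \<mu> powr (- \<epsilon>)\<close>, so \<open>\<epsilon> > 0\<close> turns into \<open>\<phi> * \<theta> < 1\<close>. The assumption \<open>gap\<close> compares
  \<open>iter B n j\<close> with the product that has one more factor at its later end, \<open>one_step\<close> compares
  products that differ by a factor at the earlier end.
\<close>
locale gapped_cocycle =
  fixes B :: "int \<Rightarrow> complex^2^2" and C M \<theta> \<phi> :: real
  assumes nonzero: "iter B n j \<noteq> 0" and bounded: "opnorm (B j) \<le> M"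
    and M: "1 \<le> M" and C: "0 < C" and \<theta>: "0 < \<theta>" "\<theta> < 1" and \<phi>: "0 < \<phi>" "\<phi> * \<theta> < 1"
    and gap: "cmod (det (iter B n j)) \<le> C * \<theta> ^ n * opnorm (iter B n j) * opnorm (iter B (Suc n) j)"
    and one_step: "1 \<le> k \<Longrightarrow> opnorm (iter B k (j + 1)) \<le> C * \<phi> ^ k * opnorm (iter B (Suc k) j)"
begin

definition K :: real where "K = 2 * C * M + 4 * C * M / (1 - \<theta>)"

lemma K_pos: "K > 0"
  unfolding K_def using C M \<theta> by (intro add_pos_pos divide_pos_pos mult_pos_pos) auto

lemma opnorm_iter_pos: "0 < opnorm (iter B n j)"
  by (rule opnorm_pos[OF nonzero])

text \<open>
  This choice is unique up to a phase, as the proof of \<open>stable_invariant\<close> shows: two directions that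
  satisfy the bound for all \<open>n\<close> are parallel.
\<close>
definition stable :: "int \<Rightarrow> complex^2" where
  "stable j = (SOME s. norm s = 1 \<and> (\<forall>n. norm (iter B n j *v s) \<le> K * \<theta> ^ n * opnorm (iter B n j)))"

lemma stable: "norm (stable j) = 1" "norm (iter B n j *v stable j) \<le> K * \<theta> ^ n * opnorm (iter B n j)"
proof -
  have "\<exists>s. norm s = 1 \<and> (\<forall>n. norm (iter B n j *v s) \<le> K * \<theta> ^ n * opnorm (iter B n j))"
    unfolding K_def
    by (rule contracted_direction[OF nonzero _ bounded M \<theta> C gap]) simp
  from someI_ex[OF this]
  show "norm (stable j) = 1" "norm (iter B n j *v stable j) \<le> K * \<theta> ^ n * opnorm (iter B n j)"
    unfolding stable_def[symmetric] by auto
qed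

definition normal :: "int \<Rightarrow> complex^2" where "normal j = perp (stable j)"

lemma norm_normal: "norm (normal j) = 1" by (simp add: normal_def stable)

lemma wedge_stable_normal: "wedge (stable j) (normal j) = 1"
  by (simp add: normal_def wedge_perp stable)

text \<open>
  In the orthonormal frames \<open>(stable j, normal j)\<close> and \<open>(stable (j + 1), normal (j + 1))\<close> the matrix
  \<open>B j\<close> is upper triangular, with diagonal \<open>b j\<close>, \<open>q j\<close> and corner \<open>x j\<close>. Intrinsically, \<open>q j\<close> is the
  action on the quotient by the stable line.
\<close>
definition "b j = wedge (B j *v stable j) (normal (j + 1))"
definition "x j = wedge (B j *v normal j) (normal (j + 1))"
definition "q j = wedge (stable (j + 1)) (B j *v normal j)"

lemma norm_B: "norm (B j *v v) \<le> M * norm v"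
  using opnorm_bound[of "B j" v] mult_right_mono[OF bounded[of j] norm_ge_zero[of v]] by linarith

lemma b_le: "cmod (b j) \<le> M" and x_le: "cmod (x j) \<le> M"
  using wedge_le[of "B j *v stable j" "normal (j + 1)"] wedge_le[of "B j *v normal j" "normal (j + 1)"]
    norm_B[of j "stable j"] norm_B[of j "normal j"]
  by (simp_all add: b_def x_def stable norm_normal)

text \<open>
  Both \<open>B j *v stable j\<close> and \<open>stable (j + 1)\<close> are contracted by \<open>iter B n (j + 1)\<close> to a fraction of
  order \<open>\<theta> ^ n\<close> of its norm, so the angle between them is zero.
\<close>
lemma stable_invariant: "B j *v stable j = b j *s stable (j + 1)"
proof -
  let ?z = "cmod (wedge (B j *v stable j) (stable (j + 1)))"
  have "?z \<le> 2 * M * K * \<theta> ^ n" for n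
  proof -
    let ?o = "opnorm (iter B n (j + 1))"
    have 1: "norm (iter B n (j + 1) *v (B j *v stable j)) \<le> M * K * \<theta> ^ n * ?o"
    proof -
      have "norm (iter B n (j + 1) *v (B j *v stable j)) = norm (iter B (Suc n) j *v stable j)"
        by (simp only: iter_Suc_right matrix_vector_mul_assoc)
      also have "\<dots> \<le> K * \<theta> ^ Suc n * opnorm (iter B (Suc n) j)" by (rule stable)
      also have "\<dots> \<le> K * \<theta> ^ n * (?o * M)"
      proof (rule mult_mono)
        show "K * \<theta> ^ Suc n \<le> K * \<theta> ^ n" using K_pos \<theta> by (intro mult_left_mono power_decreasing) auto
        show "opnorm (iter B (Suc n) j) \<le> ?o * M"
          using opnorm_mult[of "iter B n (j + 1)" "B j"] mult_left_mono[OF bounded[of j] opnorm_nonneg[of "iter B n (j + 1)"]]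
          unfolding iter_Suc_right by linarith
      qed (use K_pos \<theta> opnorm_nonneg in auto)
      finally show ?thesis by (simp add: mult_ac)
    qed
    have 2: "norm (B j *v stable j) * norm (iter B n (j + 1) *v stable (j + 1)) \<le> M * (K * \<theta> ^ n * ?o)"
      using norm_B[of j "stable j"] stable(2)[of n "j + 1"] M by (intro mult_mono) (auto simp: stable)
    have "?z * ?o \<le> (2 * M * K * \<theta> ^ n) * ?o"
      using wedge_opnorm[of "B j *v stable j" "stable (j + 1)" "iter B n (j + 1)"] 1 2
      by (simp add: stable mult_ac)
    then show ?thesis using opnorm_iter_pos[of n "j + 1"] by simp
  qed
  moreover have "(\<lambda>n. 2 * M * K * \<theta> ^ n) \<longlonglongrightarrow> 2 * M * K * 0"
    using \<theta> by (intro tendsto_mult_left LIMSEQ_power_zero) auto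
  ultimately have "?z \<le> 2 * M * K * 0"
    by (intro tendsto_lowerbound) auto
  then have "wedge (stable (j + 1)) (B j *v stable j) = 0"
    using wedge_commute[of "stable (j + 1)"] by simp
  then show ?thesis
    using frame_expansion[OF stable(1)[of "j + 1"], of "B j *v stable j"] by (simp add: b_def normal_def)
qed

lemma normal_step: "B j *v normal j = x j *s stable (j + 1) + q j *s normal (j + 1)"
  using frame_expansion[OF stable(1)[of "j + 1"], of "B j *v normal j"]
  by (simp add: x_def q_def normal_def)

lemma opnorm_frame: "opnorm A \<le> norm (A *v stable j) + norm (A *v normal j)"
  using wedge_opnorm[of "stable j" "normal j" A] by (simp add: wedge_stable_normal stable norm_normal)

text \<open>
  Precede a product of length \<open>k\<close> starting at \<open>j + 1\<close> by \<open>B j\<close>. The component of the image of \<open>B j\<close>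
  along the stable line is then contracted to a fraction of order \<open>\<theta> ^ k\<close>, so the norm of the longer product is at most
  of order \<open>\<theta> ^ k + cmod (q j)\<close> times that of the shorter one. By \<open>one_step\<close> the longer product keeps
  at least a fraction of order \<open>1 / \<phi> ^ k\<close>. As \<open>\<phi> * \<theta> < 1\<close>, for one large \<open>k\<close> the first term cannot
  account for this, and \<open>q j\<close> must.
\<close>
lemma q_bounded_below: "\<exists>c>0. \<forall>j. c \<le> cmod (q j)"
proof -
  have "(\<lambda>k. 2 * C * M * K * (\<phi> * \<theta>) ^ k) \<longlonglongrightarrow> 2 * C * M * K * 0"
    using \<theta> \<phi> by (intro tendsto_mult_left LIMSEQ_power_zero) auto
  then have "\<forall>\<^sub>F k in sequentially. 2 * C * M * K * (\<phi> * \<theta>) ^ k < 1 / 2"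
    by (rule order_tendstoD) simp
  then obtain k where k: "1 \<le> k" "2 * C * M * K * (\<phi> * \<theta>) ^ k < 1 / 2"
    unfolding eventually_sequentially by (metis linear)
  let ?c = "1 / (2 * C * \<phi> ^ k)"
  have "?c \<le> cmod (q j)" for j
  proof -
    let ?A = "iter B k (j + 1)"
    have As: "norm (?A *v stable (j + 1)) \<le> K * \<theta> ^ k * opnorm ?A" by (rule stable)
    have "norm (iter B (Suc k) j *v stable j) = cmod (b j) * norm (?A *v stable (j + 1))"
      by (simp add: iter_Suc_right matrix_vector_mul_assoc[symmetric] stable_invariant matrix_smult_vec norm_smult_vec del: iter.simps)
    also have "\<dots> \<le> M * (K * \<theta> ^ k * opnorm ?A)"
      using As b_le M by (intro mult_mono) auto
    finally have 1: "norm (iter B (Suc k) j *v stable j) \<le> M * (K * \<theta> ^ k * opnorm ?A)" .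
    have "iter B (Suc k) j *v normal j = x j *s (?A *v stable (j + 1)) + q j *s (?A *v normal (j + 1))"
      by (simp add: iter_Suc_right matrix_vector_mul_assoc[symmetric] normal_step matrix_smult_vec matrix_vector_right_distrib del: iter.simps)
    then have "norm (iter B (Suc k) j *v normal j)
        \<le> cmod (x j) * norm (?A *v stable (j + 1)) + cmod (q j) * norm (?A *v normal (j + 1))"
      by (metis norm_smult_vec norm_triangle_ineq)
    also have "\<dots> \<le> M * (K * \<theta> ^ k * opnorm ?A) + cmod (q j) * opnorm ?A"
      using As x_le M opnorm_bound[of ?A "normal (j + 1)"]
      by (intro add_mono mult_mono) (auto simp: norm_normal)
    finally have "opnorm (iter B (Suc k) j) \<le> (2 * M * K * \<theta> ^ k + cmod (q j)) * opnorm ?A"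
      using opnorm_frame[of "iter B (Suc k) j" j] 1 by (simp add: algebra_simps del: iter.simps)
    then have "C * \<phi> ^ k * opnorm (iter B (Suc k) j) \<le> C * \<phi> ^ k * ((2 * M * K * \<theta> ^ k + cmod (q j)) * opnorm ?A)"
      using C \<phi> by (intro mult_left_mono) auto
    then have "1 * opnorm ?A \<le> (C * \<phi> ^ k * (2 * M * K * \<theta> ^ k + cmod (q j))) * opnorm ?A"
      using one_step[OF k(1), of j] by (simp add: mult.assoc del: iter.simps)
    then have "1 \<le> C * \<phi> ^ k * (2 * M * K * \<theta> ^ k + cmod (q j))"
      using opnorm_iter_pos[of k "j + 1"] mult_le_cancel_right_pos by blast
    also have "\<dots> = 2 * C * M * K * (\<phi> * \<theta>) ^ k + C * \<phi> ^ k * cmod (q j)"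
      by (simp add: power_mult_distrib algebra_simps)
    finally have "1 / 2 \<le> C * \<phi> ^ k * cmod (q j)" using k(2) by linarith
    then show ?thesis using C \<phi> by (simp add: field_simps)
  qed
  moreover have "?c > 0" using C \<phi> by simp
  ultimately show ?thesis by blast
qed

text \<open>
  The corner entry of the triangular form of \<open>iter B n j\<close>; the diagonal entries are
  \<open>cocycle b n j\<close> and \<open>cocycle q n j\<close>.
\<close>
primrec shear :: "nat \<Rightarrow> int \<Rightarrow> complex" where
  "shear 0 j = 0"
| "shear (Suc n) j = b (j + int n) * shear n j + x (j + int n) * cocycle q n j"

lemma iter_normal: "iter B n j *v normal j = shear n j *s stable (j + int n) + cocycle q n j *s normal (j + int n)"
proof (induction n)
  case (Suc n)
  have "iter B (Suc n) j *v normal j = B (j + int n) *v (iter B n j *v normal j)"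
    by (simp add: matrix_vector_mul_assoc)
  also have "\<dots> = shear (Suc n) j *s stable (j + int (Suc n)) + cocycle q (Suc n) j *s normal (j + int (Suc n))"
    unfolding Suc matrix_vector_right_distrib matrix_smult_vec stable_invariant normal_step cocycle_Suc
    by (simp add: vec_eq_iff algebra_simps)
  finally show ?case .
qed simp

lemma norm_iter_stable: "norm (iter B n j *v stable j) = cmod (cocycle b n j)"
  using iter_eigen[of B stable b n j] by (simp add: stable_invariant stable norm_smult_vec)

text \<open>
  If the stable multiplier stayed comparable to the quotient multiplier, up to the factor 2, during
  \<open>n\<close> steps, then every term of the corner entry would be bounded by a multiple of \<open>cocycle b n j\<close>:
  replace the part of the term that runs along \<open>q\<close> by \<open>b\<close>. So the norm of \<open>iter B n j\<close> would be at
  most linear in \<open>n\<close> times \<open>cocycle b n j\<close>, whereas \<open>cocycle b n j\<close> is at most of order \<open>\<theta> ^ n\<close> times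
  that norm. For large \<open>n\<close> this is absurd.
\<close>
lemma uniform_drop: "\<exists>N. \<forall>j. \<exists>k\<in>{1..N}. cmod (cocycle b k j) \<le> 1 / 2 * cmod (cocycle q k j)"
proof -
  obtain c where c: "c > 0" "\<And>j. c \<le> cmod (q j)" using q_bounded_below by blast
  have "(\<lambda>n. real n * \<theta> ^ n) \<longlonglongrightarrow> 0" and "(\<lambda>n. \<theta> ^ n) \<longlonglongrightarrow> 0"
    using \<theta> by (auto intro!: powser_times_n_limit_0 LIMSEQ_power_zero)
  then have "(\<lambda>n. (2 * M / c) * K * (real n * \<theta> ^ n) + 3 * K * \<theta> ^ n) \<longlonglongrightarrow> (2 * M / c) * K * 0 + 3 * K * 0"
    by (intro tendsto_add tendsto_mult_left)
  then have "\<forall>\<^sub>F n in sequentially. (2 * M / c) * K * (real n * \<theta> ^ n) + 3 * K * \<theta> ^ n < 1"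
    by (rule order_tendstoD) simp
  then obtain n where n: "(2 * M / c) * K * (real n * \<theta> ^ n) + 3 * K * \<theta> ^ n < 1"
    unfolding eventually_sequentially by blast
  have "\<exists>k\<in>{1..n}. cmod (cocycle b k j) \<le> 1 / 2 * cmod (cocycle q k j)" for j
  proof (rule ccontr)
    assume none: "\<not> ?thesis"
    have qb: "cmod (cocycle q k j) \<le> 2 * cmod (cocycle b k j)" if "k \<le> n" for k
    proof (cases "k = 0")
      case False
      then have "k \<in> {1..n}" using that by simp
      then have "1 / 2 * cmod (cocycle q k j) < cmod (cocycle b k j)"
        using none by (meson not_le)
      then show ?thesis by simp
    qed simp
    have sh: "m \<le> n \<Longrightarrow> cmod (shear m j) \<le> 2 * M / c * real m * cmod (cocycle b m j)" for m
    proof (induction m)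
      case 0 show ?case by simp
    next
      case (Suc m)
      \<comment> \<open>One step ahead, so that in the end the full product of \<open>b\<close> appears; \<open>b\<close> itself may be
        arbitrarily small and must not be divided by.\<close>
      have "c * cmod (cocycle q m j) \<le> cmod (cocycle q (Suc m) j)"
        using c(2)[of "j + int m"] by (simp add: cocycle_Suc norm_mult mult_right_mono)
      also have "\<dots> \<le> 2 * cmod (cocycle b (Suc m) j)" using qb[OF Suc.prems] .
      finally have q1: "cmod (cocycle q m j) \<le> 2 / c * cmod (cocycle b (Suc m) j)"
        using c(1) by (simp add: field_simps)
      have "cmod (shear (Suc m) j) \<le> cmod (b (j + int m)) * cmod (shear m j) + cmod (x (j + int m)) * cmod (cocycle q m j)"
        by (metis norm_mult norm_triangle_ineq shear.simps(2))
      also have "\<dots> \<le> cmod (b (j + int m)) * (2 * M / c * real m * cmod (cocycle b m j)) + M * (2 / c * cmod (cocycle b (Suc m) j))"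
        using Suc q1 x_le M by (intro add_mono mult_mono) auto
      also have "\<dots> = 2 * M / c * real (Suc m) * cmod (cocycle b (Suc m) j)"
        using c(1) by (simp add: cocycle_Suc norm_mult add_divide_distrib algebra_simps)
      finally show ?case .
    qed
    let ?o = "opnorm (iter B n j)"
    have "norm (iter B n j *v normal j) \<le> cmod (shear n j) + cmod (cocycle q n j)"
      using iter_normal[of n j] norm_triangle_ineq[of "shear n j *s stable (j + int n)" "cocycle q n j *s normal (j + int n)"]
      by (simp add: norm_smult_vec stable norm_normal)
    then have "?o \<le> (2 * M / c * real n + 3) * cmod (cocycle b n j)"
      using opnorm_frame[of "iter B n j" j] sh[of n] qb[of n] by (simp add: norm_iter_stable algebra_simps)
    also have "\<dots> \<le> (2 * M / c * real n + 3) * (K * \<theta> ^ n * ?o)"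
      using stable(2)[of n j] M c(1) by (intro mult_left_mono) (auto simp: norm_iter_stable)
    also have "\<dots> = ((2 * M / c) * K * (real n * \<theta> ^ n) + 3 * K * \<theta> ^ n) * ?o" by (simp add: algebra_simps)
    also have "\<dots> < 1 * ?o" using n opnorm_iter_pos by (intro mult_strict_right_mono) auto
    finally show False by simp
  qed
  then show ?thesis by blast
qed

text \<open>
  By \<open>uniform_drop\<close> the quotient \<open>b / q\<close> generates an exponentially decaying cocycle. The unstable line
  is sought as the graph spanned by \<open>v j = h j *s stable j + normal j\<close>. It is invariant if and only if
  \<open>h (j + 1) = (b j / q j) * h j + x j / q j\<close>, and the bounded solution of this recursion keeps the
  line away from the stable one. Along it the multiplier is \<open>q\<close>, up to a bounded factor from
  normalizing \<open>v\<close>.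
\<close>
lemma dominated_splitting: "dominated_splitting B"
proof -
  obtain c where c: "c > 0" "\<And>j. c \<le> cmod (q j)" using q_bounded_below by blast
  have q0: "q j \<noteq> 0" for j using c(1) c(2)[of j] by auto
  obtain N where drop: "\<And>j. \<exists>k\<in>{1..N}. cmod (cocycle b k j) \<le> 1 / 2 * cmod (cocycle q k j)"
    using uniform_drop by blast
  define r where "r = (\<lambda>j. b j / q j)"
  have r: "cmod (cocycle r n j) = cmod (cocycle b n j) / cmod (cocycle q n j)" for n j
    by (simp add: r_def cocycle_divide norm_divide)
  have cq: "cmod (cocycle q n j) > 0" for n j using q0 by (simp add: cocycle_def)
  have "\<exists>L \<tau>. 1 \<le> L \<and> 0 < \<tau> \<and> \<tau> < 1 \<and> (\<forall>n i. cocycle (\<lambda>i. cmod (r i)) n i \<le> L * \<tau> ^ n)"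
  proof (rule uniform_exponential_decay[where \<tau> = "1 / 2" and R = "M / c" and N = N])
    show "cmod (r i) \<le> M / c" for i
      unfolding r_def norm_divide using b_le M c by (intro frac_le) auto
    show "\<exists>k\<in>{1..N}. cocycle (\<lambda>i. cmod (r i)) k i \<le> 1 / 2" for i
      unfolding cmod_cocycle[symmetric] r using drop[of i] cq by (simp add: field_simps)
  qed auto
  then obtain L \<tau> where L: "1 \<le> L" and \<tau>: "0 < \<tau>" "\<tau> < 1"
    and decay: "\<And>n i. cmod (cocycle r n i) \<le> L * \<tau> ^ n" unfolding cmod_cocycle by blast
  have "cmod (x i / q i) \<le> M / c" for i
    unfolding norm_divide using x_le M c by (intro frac_le) auto
  then obtain h H where h: "\<And>j. h (j + 1) = r j * h j + x j / q j" and hH: "\<And>j. cmod (h j) \<le> H"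
    using bounded_solution[of \<tau> r L "\<lambda>i. x i / q i" "M / c"] \<tau> decay by blast
  define v where "v j = h j *s stable j + normal j" for j
  have Bv: "B j *v v j = q j *s v (j + 1)" for j
  proof -
    have "q j * h (j + 1) = b j * h j + x j" unfolding h using q0[of j] by (simp add: r_def field_simps)
    then have "b j * h j + x j = q j * h (j + 1)" ..
    moreover have "B j *v v j = (b j * h j + x j) *s stable (j + 1) + q j *s normal (j + 1)"
      unfolding v_def matrix_vector_right_distrib matrix_smult_vec stable_invariant normal_step
      by (simp add: vec_eq_iff algebra_simps)
    ultimately show ?thesis by (simp add: v_def vec_eq_iff algebra_simps)
  qed
  have sv: "wedge (stable j) (v j) = 1" for j by (simp add: v_def wedge_simps wedge_stable_normal)
  have v1: "1 \<le> norm (v j)" for j using wedge_le[of "stable j" "v j"] by (simp add: sv stable)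
  have v2: "norm (v j) \<le> 1 + H" for j
    using norm_triangle_ineq[of "h j *s stable j" "normal j"] hH[of j]
    by (simp add: v_def norm_smult_vec stable norm_normal)
  have H: "1 + H > 0" using v1[of 0] v2[of 0] by linarith
  define u where "u j = complex_of_real (1 / norm (v j)) *s v j" for j
  define a where "a j = q j * complex_of_real (norm (v (j + 1)) / norm (v j))" for j
  have v0: "norm (v j) \<noteq> 0" for j using v1[of j] by linarith
  have u1: "norm (u j) = 1" for j using v0[of j] by (simp add: u_def norm_smult_vec norm_divide)
  have Bu: "B j *v u j = a j *s u (j + 1)" for j
    using v0[of j] v0[of "j + 1"] by (simp add: u_def matrix_smult_vec Bv a_def mult_ac)
  have acoc: "cocycle a n j = cocycle q n j * complex_of_real (norm (v (j + int n)) / norm (v j))" for n j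
  proof (induction n)
    case 0 show ?case using v0[of j] by simp
  next
    case (Suc n)
    show ?case unfolding cocycle_Suc Suc a_def[of "j + int n"]
      using v0[of "j + int n"] v0[of j] by (simp add: add_ac)
  qed
  have qa: "cmod (cocycle q n j) \<le> (1 + H) * cmod (cocycle a n j)" for n j
  proof -
    have "norm (v j) \<le> (1 + H) * norm (v (j + int n))"
      using v2[of j] mult_left_mono[OF v1[of "j + int n"] less_imp_le[OF H]] by simp
    moreover have "0 < norm (v j)" using v1[of j] by linarith
    ultimately have "1 \<le> (1 + H) * (norm (v (j + int n)) / norm (v j))"
      unfolding times_divide_eq_right by (simp only: pos_le_divide_eq mult_1_left)
    from mult_left_mono[OF this norm_ge_zero[of "cocycle q n j"]] show ?thesis
      by (simp add: acoc norm_mult norm_divide mult_ac)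
  qed
  have "(\<lambda>n. 2 * (1 + H) * L * \<tau> ^ n) \<longlonglongrightarrow> 2 * (1 + H) * L * 0"
    using \<tau> by (intro tendsto_mult_left LIMSEQ_power_zero) auto
  then have "\<forall>\<^sub>F n in sequentially. 2 * (1 + H) * L * \<tau> ^ n < 1"
    by (rule order_tendstoD) simp
  \<comment> \<open>With this \<open>n\<close> as \<open>N\<close> the domination holds with \<open>\<lambda> = 2\<close>.\<close>
  then obtain n where n: "1 \<le> n" "2 * (1 + H) * L * \<tau> ^ n < 1"
    unfolding eventually_sequentially by (metis linear)
  have ca: "cmod (cocycle a n j) > 0" for j
    using qa[of n j] cq[of n j] by auto
  have dom: "2 * cmod (cocycle b n j) < cmod (cocycle a n j)" for j
  proof -
    have "cmod (cocycle b n j) \<le> L * \<tau> ^ n * cmod (cocycle q n j)"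
      using decay[of n j] cq[of n j] unfolding r by (simp add: field_simps)
    also have "\<dots> \<le> L * \<tau> ^ n * ((1 + H) * cmod (cocycle a n j))"
      using qa L \<tau> by (intro mult_left_mono) auto
    finally have "2 * cmod (cocycle b n j) \<le> (2 * (1 + H) * L * \<tau> ^ n) * cmod (cocycle a n j)"
      by (simp add: algebra_simps)
    also have "\<dots> < 1 * cmod (cocycle a n j)" using n(2) ca by (intro mult_strict_right_mono) auto
    finally show ?thesis by simp
  qed
  have low: "c ^ n / (1 + H) \<le> cmod (cocycle a n j)" for j
  proof -
    have "c ^ n \<le> cmod (cocycle q n j)"
      unfolding cmod_cocycle using c by (intro cocycle_ge) auto
    also have "\<dots> \<le> (1 + H) * cmod (cocycle a n j)" by (rule qa)
    finally show ?thesis using H by (simp only: pos_divide_le_eq mult.commute)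
  qed
  have sep: "1 / (1 + H) \<le> cmod (wedge (u j) (stable j))" for j
  proof -
    have "cmod (wedge (u j) (stable j)) = 1 / norm (v j)"
      using sv[of j] wedge_commute[of "v j" "stable j"] by (simp add: u_def wedge_simps norm_mult norm_divide)
    moreover have "0 < norm (v j)" using v1[of j] by linarith
    ultimately show ?thesis using v2[of j] by (simp add: frac_le)
  qed
  have "has_multipliers B u stable a b (1 / (1 + H)) n 2 (c ^ n / (1 + H))"
    unfolding has_multipliers_def using u1 stable(1) Bu stable_invariant H sep n(1) dom low c(1) by simp
  then show ?thesis unfolding dominated_splitting_iff_multipliers by blast
qed

end

lemma dominated_splitting_if_SVG_FI:
  assumes bounded: "\<And>j. opnorm (B j) \<le> M" and M: "1 \<le> M" and C: "0 < C" and \<mu>: "1 < \<mu>" and \<epsilon>: "0 < \<epsilon>"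
    and svg: "SVG B C \<mu>" and fi: "FI B C \<mu> \<epsilon>"
  shows "dominated_splitting B"
proof -
  have nz: "iter B n j \<noteq> 0" for n j using svg by (simp add: SVG_def)
  have pos: "opnorm (iter B n j) > 0" for n j by (rule opnorm_pos[OF nz])
  define \<phi> where "\<phi> = \<mu> powr (1 - \<epsilon>)"
  have \<mu>\<theta>: "\<mu> powr (- real n) = (1 / \<mu>) ^ n" for n
    using \<mu> by (simp add: powr_minus powr_realpow power_one_over inverse_eq_divide)
  have \<mu>\<phi>: "\<mu> powr ((1 - \<epsilon>) * real n) = \<phi> ^ n" for n
    using \<mu> by (simp add: \<phi>_def powr_powr[symmetric] powr_realpow)
  have Sup_less: "y < z" if "Sup S < ereal z" "ereal y \<in> S" for S and y z :: real
    using that by (metis Sup_upper ereal_less(2) le_less_trans less_ereal.simps(1))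
  interpret gapped_cocycle B C M "1 / \<mu>" \<phi>
  proof
    show "iter B n j \<noteq> 0" for n j by (rule nz)
    show "cmod (det (iter B n j)) \<le> C * (1 / \<mu>) ^ n * opnorm (iter B n j) * opnorm (iter B (Suc n) j)" for n j
    proof -
      have "Sup (\<Union>j. {ereal (sigma2 (iter B n j) / sigma1 (iter B (n + 1) j)),
          ereal (sigma2 (iter B n (j + 1)) / sigma1 (iter B (n + 1) j))}) < ereal (C * \<mu> powr (- real n))"
        using svg unfolding SVG_def by blast
      then have "sigma2 (iter B n j) / sigma1 (iter B (n + 1) j) < C * \<mu> powr (- real n)"
        by (rule Sup_less) blast
      then show ?thesis using pos[of n j] pos[of "Suc n" j]
        unfolding \<mu>\<theta> sigma1_def sigma2_def by (simp add: field_simps del: iter.simps)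
    qed
    show "opnorm (iter B k (j + 1)) \<le> C * \<phi> ^ k * opnorm (iter B (Suc k) j)" if k: "1 \<le> k" for k j
    proof -
      have "Sup (\<Union>j. {ereal (sigma1 (iter B k j) / sigma1 (iter B (k + 1) j)),
          ereal (sigma1 (iter B k (j + 1)) / sigma1 (iter B (k + 1) j))}) < ereal (C * \<mu> powr ((1 - \<epsilon>) * real k))"
        using fi k unfolding FI_def by blast
      then have "sigma1 (iter B k (j + 1)) / sigma1 (iter B (k + 1) j) < C * \<mu> powr ((1 - \<epsilon>) * real k)"
        by (rule Sup_less) blast
      then show ?thesis using pos[of "Suc k" j]
        unfolding \<mu>\<phi> sigma1_def by (simp add: field_simps del: iter.simps)
    qed
    have "\<phi> * (1 / \<mu>) = \<mu> powr (- \<epsilon>)"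
      using \<mu> by (simp add: \<phi>_def powr_diff powr_minus_divide)
    also have "\<dots> < 1" using \<mu> \<epsilon> by (simp add: powr_less_one)
    finally show "\<phi> * (1 / \<mu>) < 1" .
  qed (use bounded M C \<mu> in \<open>simp_all add: \<phi>_def\<close>)
  show ?thesis by (rule dominated_splitting)
qed

theorem theorem1:
  fixes B :: "int \<Rightarrow> complex^2^2"
  assumes "bdd_above (range (\<lambda>j. opnorm (B j)))"
  shows "dominated_splitting B \<longleftrightarrow>
    (\<exists>C \<mu> \<epsilon> :: real. C > 0 \<and> \<mu> > 1 \<and> 0 < \<epsilon> \<and> \<epsilon> < \<mu> \<and> SVG B C \<mu> \<and> FI B C \<mu> \<epsilon>)"
proof -
  obtain M0 where "\<And>j. opnorm (B j) \<le> M0" using assms by (auto simp: bdd_above_def)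
  then have M: "opnorm (B j) \<le> max M0 1" for j by (simp add: max.coboundedI1)
  show ?thesis
  proof
    assume "dominated_splitting B"
    then obtain C \<mu> where "0 < C" "1 < \<mu>" "SVG B C \<mu>" "FI B C \<mu> 1"
      using SVG_FI_if_dominated_splitting[of B "max M0 1"] M by auto
    then show "\<exists>C \<mu> \<epsilon> :: real. C > 0 \<and> \<mu> > 1 \<and> 0 < \<epsilon> \<and> \<epsilon> < \<mu> \<and> SVG B C \<mu> \<and> FI B C \<mu> \<epsilon>"
      by (intro exI[of _ C] exI[of _ \<mu>] exI[of _ 1]) simp
  next
    assume "\<exists>C \<mu> \<epsilon> :: real. C > 0 \<and> \<mu> > 1 \<and> 0 < \<epsilon> \<and> \<epsilon> < \<mu> \<and> SVG B C \<mu> \<and> FI B C \<mu> \<epsilon>"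
    then obtain C \<mu> \<epsilon> where "0 < C" "1 < \<mu>" "0 < \<epsilon>" "SVG B C \<mu>" "FI B C \<mu> \<epsilon>"
      by blast
    then show "dominated_splitting B"
      using M by (intro dominated_splitting_if_SVG_FI[of B "max M0 1" C \<mu> \<epsilon>]) simp_all
  qed
qed

end
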